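(* Let $X$ be a topological space and let $A\subseteq X$ be a countable subset which is discrete in the subspace topology. Then the following conditions are equivalent: (i) there exists a (linear) continuous mapping $\varphi:C_p^*(A)\to C_p^*(X)$ such that $\varphi(y)|_A=y$ for every $y\in C_p^*(A)$; (ii) there exists a (linear) continuous mapping $\varphi:C_p(A)\to C_p(X)$ such that $\varphi(y)|_A=y$ for every $y\in C_p(A)$; (iii) there exists a (linear) continuous mapping $\varphi:C_p^*(A)\to C_p(X)$ such that $\varphi(y)|_A=y$ for every $y\in C_p^*(A)$; (iv) the set $A$ is strongly functionally discrete in $X$. Here the word "linear" in parentheses may be either included or omitted in (i), (ii), (iii), and the equivalence is asserted in both readings.
   Context: For a topological space $Z$ (with no separation axioms assumed), $C_p(Z)$ denotes the space of all continuous functions $y:Z\to\mathbb R$ with the topology of pointwise convergence, and $C_p^*(Z)$ denotes its subspace of all bounded continuous functions. A subset of $Z$ is functionally open if it has the form $g^{-1}(\mathbb R\setminus\{0\})$ for some continuous $g:Z\to\mathbb R$. A family of subsets of $Z$ indexed by a set is discrete if every point of $Z$ has a neighborhood which meets the members of the family for at most one index. A set $A\subseteq X$ is strongly functionally discrete in $X$ if there exists a discrete family $(G_a : a\in A)$ of functionally open subsets of $X$ with $a\in G_a$ for every $a\in A$. Subsets $A\subseteq X$ carry the subspace topology. *)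

theory Defs
  imports "HOL-Analysis.Analysis"
begin

text \<open>
  Elements of a function space over \<open>Z\<close> are represented as extensional functions on
  \<open>topspace Z\<close> (value \<open>undefined\<close> outside), as is built into \<^const>\<open>product_topology\<close>.
\<close>

definition Cp :: "'a topology \<Rightarrow> ('a \<Rightarrow> real) topology" where
  "Cp Z = subtopology (product_topology (\<lambda>_. euclideanreal) (topspace Z))
            {y. continuous_map Z euclideanreal y}"

definition Cp_star :: "'a topology \<Rightarrow> ('a \<Rightarrow> real) topology" where
  "Cp_star Z = subtopology (Cp Z) {y. bounded (y ` topspace Z)}"

definition functionally_open_in :: "'a topology \<Rightarrow> 'a set \<Rightarrow> bool" where
  "functionally_open_in Z U \<longleftrightarrow>
     (\<exists>g. continuous_map Z euclideanreal g \<and> U = {x \<in> topspace Z. g x \<noteq> 0})"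

definition discrete_family_in :: "'a topology \<Rightarrow> 'i set \<Rightarrow> ('i \<Rightarrow> 'a set) \<Rightarrow> bool" where
  "discrete_family_in Z I G \<longleftrightarrow>
     (\<forall>i\<in>I. G i \<subseteq> topspace Z) \<and>
     (\<forall>x\<in>topspace Z. \<exists>U. openin Z U \<and> x \<in> U \<and>
        (\<forall>i\<in>I. \<forall>j\<in>I. G i \<inter> U \<noteq> {} \<and> G j \<inter> U \<noteq> {} \<longrightarrow> i = j))"

definition strongly_functionally_discrete_in :: "'a topology \<Rightarrow> 'a set \<Rightarrow> bool" where
  "strongly_functionally_discrete_in X A \<longleftrightarrow>
     (\<exists>G. discrete_family_in X A G \<and> (\<forall>a\<in>A. functionally_open_in X (G a) \<and> a \<in> G a))"

definition continuous_extender ::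
    "'a set \<Rightarrow> ('a \<Rightarrow> real) topology \<Rightarrow> ('a \<Rightarrow> real) topology \<Rightarrow> (('a \<Rightarrow> real) \<Rightarrow> ('a \<Rightarrow> real)) \<Rightarrow> bool" where
  "continuous_extender A E F \<phi> \<longleftrightarrow>
     continuous_map E F \<phi> \<and> (\<forall>y\<in>topspace E. restrict (\<phi> y) A = y)"

text \<open>
  Linearity on a carrier \<open>V\<close> of extensional functions on \<open>S\<close>, with values in the extensional
  functions on \<open>T\<close>. The pointwise operations are restricted to \<open>S\<close> and \<open>T\<close> so that they
  remain within the extensional functions.
\<close>

definition linear_fun_map ::
    "'a set \<Rightarrow> 'b set \<Rightarrow> ('a \<Rightarrow> real) set \<Rightarrow> (('a \<Rightarrow> real) \<Rightarrow> ('b \<Rightarrow> real)) \<Rightarrow> bool" where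
  "linear_fun_map S T V \<phi> \<longleftrightarrow>
     (\<forall>y\<in>V. \<forall>z\<in>V. \<phi> (\<lambda>a\<in>S. y a + z a) = (\<lambda>x\<in>T. \<phi> y x + \<phi> z x)) \<and>
     (\<forall>c. \<forall>y\<in>V. \<phi> (\<lambda>a\<in>S. c * y a) = (\<lambda>x\<in>T. c * \<phi> y x))"

definition linear_continuous_extender ::
    "'a topology \<Rightarrow> 'a set \<Rightarrow> ('a \<Rightarrow> real) topology \<Rightarrow> ('a \<Rightarrow> real) topology \<Rightarrow> (('a \<Rightarrow> real) \<Rightarrow> ('a \<Rightarrow> real)) \<Rightarrow> bool" where
  "linear_continuous_extender X A E F \<phi> \<longleftrightarrow>
     continuous_extender A E F \<phi> \<and> linear_fun_map A (topspace X) (topspace E) \<phi>"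

end

theory Submission
  imports Defs
begin

text \<open>
  The substantial implication is the one from a continuous extender on the bounded functions to strong
  functional discreteness. Enumerate \<open>A\<close> injectively by \<open>e\<close> and let \<open>t\<^sub>k\<close> be the indicator of the
  tail \<open>{a \<in> A. k \<le> e a}\<close>. The tails shrink to the empty set, so \<open>t\<^sub>k\<close> converges pointwise to the
  zero function, and continuity of \<open>\<phi>\<close> gives a sequence \<open>h\<^sub>k = \<phi> t\<^sub>k - \<phi> 0\<close> of continuous functions
  on \<open>X\<close> that extend the \<open>t\<^sub>k\<close> and still converge to \<open>0\<close> at every point of \<open>X\<close>. The points of \<open>A\<close>
  are separated by where \<open>h\<^sub>k\<close> drops from \<open>1\<close> to \<open>0\<close>: the sets
  \<open>G\<^sub>a = {x. h\<^sub>k x > 2/3 for k \<le> e a, and h\<^sub>k x < 1/3 for k = e a + 1}\<close> form a discrete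
  family (lemma \<open>strongly_functionally_discrete_in_if_tail_extensions\<close>). At a point \<open>x\<close>, if \<open>k\<close> is
  the first index with \<open>h\<^sub>k x < 2/3\<close>, then the neighbourhood on which \<open>h\<^sub>k < 2/3\<close> and \<open>h\<^sub>j > 1/3\<close>
  for \<open>j < k\<close> can meet \<open>G\<^sub>a\<close> only if \<open>e a + 1 = k\<close>. Only continuity of \<open>\<phi>\<close> at zero is used, and
  linearity plays no role. The other extenders reduce to this case by enlarging the codomain from
  bounded to all continuous functions, or by restricting the domain to the bounded ones.

  Conversely, a discrete family of functionally open sets carries bump functions \<open>f\<^sub>a\<close> with values
  in the unit interval and \<open>f\<^sub>a a = 1\<close>, and \<open>y \<mapsto> (\<Sum>a. y a * f\<^sub>a)\<close>, in which locally at most one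
  term is nonzero, is a linear continuous extender that preserves boundedness.
\<close>

section \<open>Function spaces\<close>

lemma topspace_Cp:
  "topspace (Cp Z) = {y \<in> extensional (topspace Z). continuous_map Z euclideanreal y}"
  by (auto simp: Cp_def PiE_def)

lemma topspace_Cp_star:
  "topspace (Cp_star Z) =
     {y \<in> extensional (topspace Z). continuous_map Z euclideanreal y \<and> bounded (y ` topspace Z)}"
  by (auto simp: Cp_star_def topspace_Cp)

lemma continuous_map_into_Cp:
  assumes "\<And>y. y \<in> topspace E \<Longrightarrow> \<phi> y \<in> topspace (Cp Z)"
    and "\<And>x. x \<in> topspace Z \<Longrightarrow> continuous_map E euclideanreal (\<lambda>y. \<phi> y x)"
  shows "continuous_map E (Cp Z) \<phi>"
  using assms unfolding Cp_def continuous_map_in_subtopology continuous_map_componentwise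
  by (auto simp: PiE_def)

lemma continuous_map_Cp_eval:
  assumes "x \<in> topspace Z"
  shows "continuous_map (Cp Z) euclideanreal (\<lambda>y. y x)"
  unfolding Cp_def
  by (intro continuous_map_from_subtopology continuous_map_product_projection assms)

lemma limitin_Cp_star:
  assumes "\<And>n. s n \<in> topspace (Cp_star Z)" "l \<in> topspace (Cp_star Z)"
    and "\<And>x. x \<in> topspace Z \<Longrightarrow> (\<lambda>n. s n x) \<longlonglongrightarrow> l x"
  shows "limitin (Cp_star Z) s l sequentially"
  using assms unfolding topspace_Cp_star
  by (auto simp: Cp_star_def Cp_def limitin_subtopology limitin_componentwise PiE_def)

section \<open>From an extender to a discrete family\<close>

text \<open>
  The enumeration \<open>e\<close> need not be onto, which covers finite \<open>A\<close> as well. The gap between \<open>1/3\<close>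
  and \<open>2/3\<close> makes the family discrete and not just disjoint and locally finite.
\<close>
lemma strongly_functionally_discrete_in_if_tail_extensions:
  fixes e :: "'a \<Rightarrow> nat" and h :: "nat \<Rightarrow> 'a \<Rightarrow> real"
  assumes A: "A \<subseteq> topspace X" and e: "inj_on e A"
    and cont: "\<And>k. continuous_map X euclideanreal (h k)"
    and hA: "\<And>k a. a \<in> A \<Longrightarrow> h k a = (if k \<le> e a then 1 else 0)"
    and lim: "\<And>x. x \<in> topspace X \<Longrightarrow> (\<lambda>k. h k x) \<longlonglongrightarrow> 0"
  shows "strongly_functionally_discrete_in X A"
proof -
  define G where "G a = {x \<in> topspace X. (\<forall>k\<le>e a. h k x > 2/3) \<and> h (Suc (e a)) x < 1/3}" for a
  have "functionally_open_in X (G a)" for a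
  proof -
    define g where
      "g x = (\<Prod>k\<le>e a. max 0 (h k x - 2/3)) * max 0 (1/3 - h (Suc (e a)) x)" for x
    have "continuous_map X euclideanreal g"
      unfolding g_def
      by (intro continuous_map_real_mult continuous_map_prod continuous_map_real_max
          continuous_map_diff continuous_map_canonical_const cont) auto
    moreover have "max 0 r \<noteq> 0 \<longleftrightarrow> r > 0" for r :: real
      by (auto simp: max_def)
    then have "G a = {x \<in> topspace X. g x \<noteq> 0}"
      by (auto simp: G_def g_def)
    ultimately show ?thesis
      unfolding functionally_open_in_def by blast
  qed
  moreover have "a \<in> G a" if "a \<in> A" for a
    using that A by (auto simp: G_def hA)
  moreover have "discrete_family_in X A G"
    unfolding discrete_family_in_def
  proof (intro conjI ballI)
    show "G a \<subseteq> topspace X" for a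
      by (auto simp: G_def)
  next
    fix x assume x: "x \<in> topspace X"
    have "\<exists>k. h k x < 2/3"
      using eventually_happens[OF order_tendstoD(2)[OF lim[OF x], of "2/3"]] by auto
    \<comment> \<open>Minimality of \<open>k\<close> keeps each \<open>h j\<close> with \<open>j < k\<close> above \<open>1/3\<close> near \<open>x\<close>.\<close>
    define k where "k = (LEAST k. h k x < 2/3)"
    have k: "h k x < 2/3"
      unfolding k_def by (rule LeastI_ex) fact
    have less: "h j x > 1/3" if "j < k" for j
      using not_less_Least[of j "\<lambda>k. h k x < 2/3"] that by (simp add: k_def)
    define U where
      "U = {z \<in> topspace X. h k z \<in> {..<2/3}} \<inter>
           ((\<Inter>j\<in>{..<k}. {z \<in> topspace X. h j z \<in> {1/3<..}}) \<inter> topspace X)"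
    have op: "openin X {z \<in> topspace X. h j z \<in> V}" if "open V" for j V
      using cont[of j] that by (auto simp: continuous_map_def)
    have "openin X U"
      unfolding U_def
    proof (rule openin_Int)
      show "openin X ((\<Inter>j\<in>{..<k}. {z \<in> topspace X. h j z \<in> {1/3<..}}) \<inter> topspace X)"
        by (rule openin_INT) (simp, rule op, simp)
    qed (rule op, simp)
    moreover have "x \<in> U"
      using x k less by (auto simp: U_def)
    moreover have "Suc (e i) = k" if meet: "G i \<inter> U \<noteq> {}" for i
    proof -
      obtain z where z: "z \<in> G i" "z \<in> U"
        using meet by auto
      have "\<not> k \<le> e i"
        using z by (force simp: G_def U_def)
      moreover have "\<not> Suc (e i) < k"
        using z by (force simp: G_def U_def)
      ultimately show ?thesis
        by simp
    qed
    ultimately show "\<exists>U. openin X U \<and> x \<in> U \<and>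
        (\<forall>i\<in>A. \<forall>j\<in>A. G i \<inter> U \<noteq> {} \<and> G j \<inter> U \<noteq> {} \<longrightarrow> i = j)"
      using e unfolding inj_on_def by (metis nat.inject)
  qed
  ultimately show ?thesis
    unfolding strongly_functionally_discrete_in_def by blast
qed

lemma strongly_functionally_discrete_in_if_continuous_extender:
  assumes A: "A \<subseteq> topspace X" and "countable A"
    and discr: "subtopology X A = discrete_topology A"
    and ext: "continuous_extender A (Cp_star (subtopology X A)) (Cp X) \<phi>"
  shows "strongly_functionally_discrete_in X A"
proof -
  let ?E = "Cp_star (discrete_topology A)"
  obtain e :: "'a \<Rightarrow> nat" where e: "inj_on e A"
    using \<open>countable A\<close> by (auto simp: countable_def)
  define t :: "nat \<Rightarrow> 'a \<Rightarrow> real" where "t k = (\<lambda>a\<in>A. if k \<le> e a then 1 else 0)" for k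
  define o0 :: "'a \<Rightarrow> real" where "o0 = (\<lambda>a\<in>A. 0)"
  have t: "t k \<in> topspace ?E" for k
  proof -
    have "t k ` A \<subseteq> {0, 1}"
      by (auto simp: t_def)
    then have "bounded (t k ` A)"
      by (rule bounded_subset[rotated]) auto
    then show ?thesis
      by (simp add: topspace_Cp_star continuous_map_from_discrete_topology t_def)
  qed
  have o0: "o0 \<in> topspace ?E"
    by (auto simp: topspace_Cp_star o0_def image_constant_conv)
  have cont: "continuous_map ?E (Cp X) \<phi>" and
    agree: "\<And>y a. y \<in> topspace ?E \<Longrightarrow> a \<in> A \<Longrightarrow> \<phi> y a = y a"
    using ext unfolding continuous_extender_def discr by (auto, metis restrict_apply')
  have \<phi>: "continuous_map X euclideanreal (\<phi> y)" if "y \<in> topspace ?E" for y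
    using continuous_map_funspace[OF cont] that by (auto simp: topspace_Cp)
  have lim_t: "limitin ?E t o0 sequentially"
  proof (rule limitin_Cp_star[OF t o0])
    fix a assume "a \<in> topspace (discrete_topology A)"
    then have "a \<in> A" by simp
    have "eventually (\<lambda>k. t k a = o0 a) sequentially"
      using eventually_gt_at_top[of "e a"]
      by eventually_elim (use \<open>a \<in> A\<close> in \<open>auto simp: t_def o0_def\<close>)
    then show "(\<lambda>k. t k a) \<longlonglongrightarrow> o0 a"
      by (rule tendsto_eventually)
  qed
  define h where "h k x = \<phi> (t k) x - \<phi> o0 x" for k x
  show ?thesis
  proof (rule strongly_functionally_discrete_in_if_tail_extensions[OF A e])
    show "continuous_map X euclideanreal (h k)" for k
      unfolding h_def by (intro continuous_map_diff \<phi> t o0)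
    show "h k a = (if k \<le> e a then 1 else 0)" if "a \<in> A" for k a
      using that by (simp add: h_def agree t o0) (simp add: t_def o0_def)
    fix x assume "x \<in> topspace X"
    then have "limitin euclideanreal ((\<lambda>y. \<phi> y x) \<circ> t) (\<phi> o0 x) sequentially"
      using continuous_map_compose[OF cont continuous_map_Cp_eval] lim_t
      by (intro continuous_map_limit) (auto simp: o_def)
    then have "(\<lambda>k. \<phi> (t k) x) \<longlonglongrightarrow> \<phi> o0 x"
      by (simp add: o_def)
    then show "(\<lambda>k. h k x) \<longlonglongrightarrow> 0"
      unfolding h_def by (simp add: LIM_zero)
  qed
qed

section \<open>From a discrete family to an extender\<close>

lemma functionally_open_in_bump:
  assumes "functionally_open_in Z U" "a \<in> U"
  obtains f :: "'a \<Rightarrow> real" where "continuous_map Z euclideanreal f" "f a = 1"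
    "\<forall>x. 0 \<le> f x" "\<forall>x. f x \<le> 1" "\<forall>x\<in>topspace Z. x \<notin> U \<longrightarrow> f x = 0"
proof -
  obtain g where g: "continuous_map Z euclideanreal g" "U = {x \<in> topspace Z. g x \<noteq> 0}"
    using assms(1) by (auto simp: functionally_open_in_def)
  define f where "f x = min 1 (\<bar>g x\<bar> * (1 / \<bar>g a\<bar>))" for x
  show thesis
  proof
    show "continuous_map Z euclideanreal f"
      unfolding f_def
      by (intro continuous_map_real_min continuous_map_real_mult continuous_map_real_abs
          continuous_map_canonical_const g)
  qed (use g assms(2) in \<open>auto simp: f_def\<close>)
qed

text \<open>
  The extension of \<open>y\<close> from \<open>A\<close> to \<open>X\<close> by bump functions \<open>f a\<close> supported in the members \<open>G a\<close> of
  a discrete family.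
  At each point the index set of the sum has at most one element; the sum thus selects
  the term of the unique member of the family containing the point, and is zero if there is none.
\<close>
definition sum_extension ::
    "'a topology \<Rightarrow> 'a set \<Rightarrow> ('a \<Rightarrow> 'a set) \<Rightarrow> ('a \<Rightarrow> 'a \<Rightarrow> real) \<Rightarrow> ('a \<Rightarrow> real) \<Rightarrow> 'a \<Rightarrow> real" where
  "sum_extension X A G f y = (\<lambda>x\<in>topspace X. \<Sum>a\<in>{a \<in> A. x \<in> G a}. y a * f a x)"

text \<open>
  A discrete family of sets \<open>G a\<close> around the points \<open>a \<in> A\<close>, with continuous bump functions \<open>f a\<close>
  that vanish outside \<open>G a\<close> and equal \<open>1\<close> at \<open>a\<close>.
\<close>
locale bump_family =
  fixes X :: "'a topology" and A :: "'a set" and G :: "'a \<Rightarrow> 'a set" and f :: "'a \<Rightarrow> 'a \<Rightarrow> real"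
  assumes A: "A \<subseteq> topspace X"
    and discr: "discrete_family_in X A G"
    and in_G: "\<And>a. a \<in> A \<Longrightarrow> a \<in> G a"
    and cont: "\<And>a. a \<in> A \<Longrightarrow> continuous_map X euclideanreal (f a)"
    and f_1: "\<And>a. a \<in> A \<Longrightarrow> f a a = 1"
    and f_ge: "\<And>a x. a \<in> A \<Longrightarrow> 0 \<le> f a x"
    and f_le: "\<And>a x. a \<in> A \<Longrightarrow> f a x \<le> 1"
    and f_0: "\<And>a x. a \<in> A \<Longrightarrow> x \<in> topspace X \<Longrightarrow> x \<notin> G a \<Longrightarrow> f a x = 0"
begin

abbreviation "\<Phi> \<equiv> sum_extension X A G f"

lemma index_unique:
  assumes "x \<in> topspace X" "a \<in> A" "b \<in> A" "x \<in> G a" "x \<in> G b"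
  shows "a = b"
proof -
  obtain U where "x \<in> U" and "\<forall>i\<in>A. \<forall>j\<in>A. G i \<inter> U \<noteq> {} \<and> G j \<inter> U \<noteq> {} \<longrightarrow> i = j"
    using bspec[OF conjunct2[OF discr[unfolded discrete_family_in_def]] assms(1)] by (elim exE conjE)
  with assms show ?thesis by blast
qed

lemma finite_index:
  assumes "x \<in> topspace X"
  shows "finite {a \<in> A. x \<in> G a}"
proof (cases "\<exists>b\<in>A. x \<in> G b")
  case True
  then obtain b where "b \<in> A" "x \<in> G b" by blast
  then have "{a \<in> A. x \<in> G a} \<subseteq> {b}"
    using index_unique[OF assms] by blast
  then show ?thesis
    by (rule finite_subset) simp
qed (auto intro: finite_subset[of _ "{}"])

lemma sum_extension_eq:
  assumes "x \<in> topspace X" "b \<in> A" and "\<And>a. a \<in> A \<Longrightarrow> x \<in> G a \<Longrightarrow> a = b"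
  shows "\<Phi> y x = y b * f b x"
proof (cases "x \<in> G b")
  case True
  have "{a \<in> A. x \<in> G a} = {b}"
    using True assms(2,3) by blast
  then show ?thesis
    using assms(1) by (simp add: sum_extension_def)
next
  case False
  have "{a \<in> A. x \<in> G a} = {}"
    using False assms(3) by blast
  then show ?thesis
    using assms(1) f_0[OF assms(2,1) False] unfolding sum_extension_def
    by (simp only: restrict_apply if_True sum.empty mult_zero_right)
qed

lemma sum_extension_eq_0:
  assumes "x \<in> topspace X" and "\<And>a. a \<in> A \<Longrightarrow> x \<notin> G a"
  shows "\<Phi> y x = 0"
proof -
  have "{a \<in> A. x \<in> G a} = {}" using assms by auto
  then show ?thesis
    using assms(1) unfolding sum_extension_def by (simp only: restrict_apply if_True sum.empty)
qed

lemma sum_extension_extends: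
  assumes "y \<in> extensional A"
  shows "restrict (\<Phi> y) A = y"
proof
  fix x
  show "restrict (\<Phi> y) A x = y x"
  proof (cases "x \<in> A")
    case True
    then have "\<Phi> y x = y x * f x x"
      using A by (intro sum_extension_eq) (auto intro: index_unique in_G)
    then show ?thesis
      using True by (simp add: f_1)
  qed (use assms in \<open>auto simp: extensional_def\<close>)
qed

lemma continuous_map_sum_extension: "continuous_map X euclideanreal (\<Phi> y)"
proof -
  have "\<exists>U. openin X U \<and> x \<in> U \<and> continuous_map (subtopology X U) euclideanreal (\<Phi> y)"
    if x: "x \<in> topspace X" for x
  proof -
    obtain U where U: "openin X U" "x \<in> U"
      and "\<forall>i\<in>A. \<forall>j\<in>A. G i \<inter> U \<noteq> {} \<and> G j \<inter> U \<noteq> {} \<longrightarrow> i = j"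
      using bspec[OF conjunct2[OF discr[unfolded discrete_family_in_def]] x] by (elim exE conjE)
    then have uniq: "i = j" if "i \<in> A" "j \<in> A" "z \<in> G i" "z \<in> U" "G j \<inter> U \<noteq> {}" for i j z
      using that by blast
    have "continuous_map (subtopology X U) euclideanreal (\<Phi> y)"
    proof (cases "\<exists>b\<in>A. G b \<inter> U \<noteq> {}")
      case True
      then obtain b where b: "b \<in> A" "G b \<inter> U \<noteq> {}" by blast
      have eq: "y b * f b z = \<Phi> y z" if "z \<in> topspace (subtopology X U)" for z
        by (rule sum_extension_eq[symmetric]) (use that b in \<open>auto intro: uniq\<close>)
      have "continuous_map (subtopology X U) euclideanreal (\<lambda>z. y b * f b z)"
        by (intro continuous_map_real_mult continuous_map_canonical_const
            continuous_map_from_subtopology cont b)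
      then show ?thesis
        by (rule continuous_map_eq) (use eq in auto)
    next
      case False
      have eq: "0 = \<Phi> y z" if "z \<in> topspace (subtopology X U)" for z
        by (rule sum_extension_eq_0[symmetric]) (use that False in auto)
      have "continuous_map (subtopology X U) euclideanreal (\<lambda>z. 0)"
        by simp
      then show ?thesis
        by (rule continuous_map_eq) (use eq in auto)
    qed
    with U(1,2) show ?thesis
      by (intro exI[of _ U] conjI)
  qed
  \<comment> \<open>Paste along all open sets on which the extension is continuous; they cover \<open>X\<close>.\<close>
  then have "\<exists>U. U \<in> {U. openin X U \<and> continuous_map (subtopology X U) euclideanreal (\<Phi> y)}
      \<and> x \<in> U \<and> \<Phi> y x = \<Phi> y x" if "x \<in> topspace X" for x
    using that by blast
  then show ?thesis
    by (rule pasting_lemma[where T = "\<lambda>U. U" and f = "\<lambda>_. \<Phi> y", rotated 3]) auto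
qed

lemma bounded_sum_extension:
  assumes "bounded (y ` A)"
  shows "bounded (\<Phi> y ` topspace X)"
proof -
  obtain B where B: "B > 0" "\<And>a. a \<in> A \<Longrightarrow> \<bar>y a\<bar> \<le> B"
    using assms by (auto simp: bounded_pos)
  have "\<bar>\<Phi> y x\<bar> \<le> B" if x: "x \<in> topspace X" for x
  proof (cases "\<exists>b\<in>A. x \<in> G b")
    case True
    then obtain b where b: "b \<in> A" "x \<in> G b" by blast
    then have "\<Phi> y x = y b * f b x"
      using x by (intro sum_extension_eq) (auto intro: index_unique)
    moreover have "\<bar>y b * f b x\<bar> \<le> B * 1"
      unfolding abs_mult using b B f_ge f_le by (intro mult_mono) auto
    ultimately show ?thesis by simp
  next
    case False
    then show ?thesis
      using sum_extension_eq_0[OF x] B by auto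
  qed
  then show ?thesis
    by (auto simp: bounded_iff)
qed

lemma topspace_sub: "topspace (subtopology X A) = A"
  using A by auto

lemma continuous_map_Cp_sum_extension: "continuous_map (Cp (subtopology X A)) (Cp X) \<Phi>"
proof (rule continuous_map_into_Cp)
  show "\<Phi> y \<in> topspace (Cp X)" for y
    using continuous_map_sum_extension by (simp add: topspace_Cp) (simp add: sum_extension_def)
  fix x assume x: "x \<in> topspace X"
  have "continuous_map (Cp (subtopology X A)) euclideanreal
          (\<lambda>y. \<Sum>a\<in>{a \<in> A. x \<in> G a}. y a * f a x)"
    using finite_index[OF x]
    by (intro continuous_map_sum continuous_map_real_mult continuous_map_canonical_const
        continuous_map_Cp_eval) (auto simp: topspace_sub simp del: topspace_subtopology)
  then show "continuous_map (Cp (subtopology X A)) euclideanreal (\<lambda>y. \<Phi> y x)"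
    using x by (simp add: sum_extension_def)
qed

lemma continuous_map_Cp_star_sum_extension:
  "continuous_map (Cp_star (subtopology X A)) (Cp_star X) \<Phi>"
  unfolding Cp_star_def[of X] continuous_map_in_subtopology
proof
  show "continuous_map (Cp_star (subtopology X A)) (Cp X) \<Phi>"
    unfolding Cp_star_def
    by (intro continuous_map_from_subtopology continuous_map_Cp_sum_extension)
  show "\<Phi> \<in> topspace (Cp_star (subtopology X A)) \<rightarrow> {y. bounded (y ` topspace X)}"
    using bounded_sum_extension by (auto simp: topspace_Cp_star topspace_sub
        simp del: topspace_subtopology)
qed

lemma linear_sum_extension: "linear_fun_map A (topspace X) V \<Phi>"
  unfolding linear_fun_map_def
proof (intro conjI ballI allI)
  show "\<Phi> (\<lambda>a\<in>A. y a + z a) = (\<lambda>x\<in>topspace X. \<Phi> y x + \<Phi> z x)" for y z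
    by (simp add: sum_extension_def fun_eq_iff distrib_right flip: sum.distrib)
  show "\<Phi> (\<lambda>a\<in>A. c * y a) = (\<lambda>x\<in>topspace X. c * \<Phi> y x)" for c y
    by (simp add: sum_extension_def fun_eq_iff sum_distrib_left mult.assoc)
qed

lemma linear_continuous_extender_Cp:
  "linear_continuous_extender X A (Cp (subtopology X A)) (Cp X) \<Phi>"
  using continuous_map_Cp_sum_extension linear_sum_extension sum_extension_extends
  by (auto simp: linear_continuous_extender_def continuous_extender_def topspace_Cp topspace_sub
      simp del: topspace_subtopology)

lemma linear_continuous_extender_Cp_star:
  "linear_continuous_extender X A (Cp_star (subtopology X A)) (Cp_star X) \<Phi>"
  using continuous_map_Cp_star_sum_extension linear_sum_extension sum_extension_extends
  by (auto simp: linear_continuous_extender_def continuous_extender_def topspace_Cp_star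
      topspace_sub simp del: topspace_subtopology)

end

lemma strongly_functionally_discrete_in_bump_family:
  assumes "A \<subseteq> topspace X" "strongly_functionally_discrete_in X A"
  obtains G f where "bump_family X A G f"
proof -
  obtain G where G: "discrete_family_in X A G"
    "\<And>a. a \<in> A \<Longrightarrow> functionally_open_in X (G a)" "\<And>a. a \<in> A \<Longrightarrow> a \<in> G a"
    using assms(2) unfolding strongly_functionally_discrete_in_def by blast
  define bump where "bump a f \<longleftrightarrow> continuous_map X euclideanreal f \<and> f a = 1 \<and> (\<forall>x. 0 \<le> f x) \<and>
      (\<forall>x. f x \<le> 1) \<and> (\<forall>x\<in>topspace X. x \<notin> G a \<longrightarrow> f x = 0)" for a and f :: "'a \<Rightarrow> real"
  have "\<forall>a\<in>A. \<exists>f. bump a f"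
  proof
    fix a assume "a \<in> A"
    obtain f where "continuous_map X euclideanreal f" "f a = 1" "\<forall>x. 0 \<le> f x" "\<forall>x. f x \<le> 1"
      "\<forall>x\<in>topspace X. x \<notin> G a \<longrightarrow> f x = 0"
      by (rule functionally_open_in_bump[OF G(2,3)[OF \<open>a \<in> A\<close>]])
    then have "bump a f"
      by (simp add: bump_def)
    then show "\<exists>f. bump a f"
      by blast
  qed
  then obtain f where "\<forall>a\<in>A. bump a (f a)"
    by (rule bchoice[THEN exE])
  then have "bump_family X A G f"
    using assms(1) G by unfold_locales (auto simp: bump_def)
  then show thesis ..
qed

section \<open>Equivalence of the conditions\<close>

lemma linear_continuous_extenderD:
  "linear_continuous_extender X A E F \<phi> \<Longrightarrow> continuous_extender A E F \<phi>"
  by (simp add: linear_continuous_extender_def)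

lemma continuous_extender_Cp_star_codomain:
  "continuous_extender A E (Cp_star X) \<phi> \<Longrightarrow> continuous_extender A E (Cp X) \<phi>"
  by (simp add: continuous_extender_def Cp_star_def[of X] continuous_map_in_subtopology)

lemma linear_continuous_extender_Cp_star_codomain:
  "linear_continuous_extender X A E (Cp_star X) \<phi> \<Longrightarrow> linear_continuous_extender X A E (Cp X) \<phi>"
  by (simp add: linear_continuous_extender_def continuous_extender_Cp_star_codomain)

lemma continuous_extender_Cp_star_domain:
  "continuous_extender A (Cp Z) F \<phi> \<Longrightarrow> continuous_extender A (Cp_star Z) F \<phi>"
  by (auto simp: continuous_extender_def Cp_star_def continuous_map_from_subtopology)

theorem theorem2p3:
  fixes X :: "'a topology" and A :: "'a set"
  assumes "A \<subseteq> topspace X"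
    and "countable A"
    and "subtopology X A = discrete_topology A"
  shows
    "(((\<exists>\<phi>. continuous_extender A (Cp_star (subtopology X A)) (Cp_star X) \<phi>)
         \<longleftrightarrow> strongly_functionally_discrete_in X A) \<and>
      ((\<exists>\<phi>. continuous_extender A (Cp (subtopology X A)) (Cp X) \<phi>)
         \<longleftrightarrow> strongly_functionally_discrete_in X A) \<and>
      ((\<exists>\<phi>. continuous_extender A (Cp_star (subtopology X A)) (Cp X) \<phi>)
         \<longleftrightarrow> strongly_functionally_discrete_in X A)) \<and>
     (((\<exists>\<phi>. linear_continuous_extender X A (Cp_star (subtopology X A)) (Cp_star X) \<phi>)
         \<longleftrightarrow> strongly_functionally_discrete_in X A) \<and>
      ((\<exists>\<phi>. linear_continuous_extender X A (Cp (subtopology X A)) (Cp X) \<phi>)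
         \<longleftrightarrow> strongly_functionally_discrete_in X A) \<and>
      ((\<exists>\<phi>. linear_continuous_extender X A (Cp_star (subtopology X A)) (Cp X) \<phi>)
         \<longleftrightarrow> strongly_functionally_discrete_in X A))"
proof -
  let ?iv = "strongly_functionally_discrete_in X A"
  have iii_iv: ?iv if "continuous_extender A (Cp_star (subtopology X A)) (Cp X) \<phi>" for \<phi>
    using strongly_functionally_discrete_in_if_continuous_extender assms that by blast
  have i_iv: ?iv if "continuous_extender A (Cp_star (subtopology X A)) (Cp_star X) \<phi>" for \<phi>
    using that by (intro iii_iv continuous_extender_Cp_star_codomain)
  have ii_iv: ?iv if "continuous_extender A (Cp (subtopology X A)) (Cp X) \<phi>" for \<phi>
    using that by (intro iii_iv continuous_extender_Cp_star_domain)
  have ext: "(\<exists>\<phi>. linear_continuous_extender X A (Cp_star (subtopology X A)) (Cp_star X) \<phi>) \<and>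
      (\<exists>\<phi>. linear_continuous_extender X A (Cp (subtopology X A)) (Cp X) \<phi>)" if iv: ?iv
  proof -
    obtain G f where "bump_family X A G f"
      using strongly_functionally_discrete_in_bump_family[OF assms(1) iv] .
    then interpret bump_family X A G f .
    show ?thesis
      using linear_continuous_extender_Cp linear_continuous_extender_Cp_star by blast
  qed
  have iii: "\<exists>\<phi>. linear_continuous_extender X A (Cp_star (subtopology X A)) (Cp X) \<phi>" if ?iv
    using ext[OF that] linear_continuous_extender_Cp_star_codomain by blast
  show ?thesis
    by (intro conjI iffI)
      (use i_iv ii_iv iii_iv ext iii linear_continuous_extenderD in blast)+
qed

end
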